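(* If $k\geq 2$ is an odd integer, then $L_k(0)=-1$, and $L_k(-n)=0$ for every positive integer $n$.
   Context: For an integer $k\ge 2$, $P_k(x)=\frac{(2x+k-1)(x+1)(x+2)\cdots(x+k-2)}{(k-1)!}$. The Minakshisundaram–Pleijel zeta function of the real projective space $P^k$ is $L_k(s)=\sum_{n=1}^{\infty}\frac{P_k(2n)}{[2n(2n+k-1)]^s}$ for $\mathrm{Re}\,s>k/2$; $L_k$ also denotes its meromorphic continuation to $\mathbb{C}$ (whose poles lie in $\{k/2-n:n\in\mathbb{Z}_{\ge0}\}$), and $L_k(0)$, $L_k(-n)$ denote values of this continuation. *)

theory Defs
  imports "HOL-Complex_Analysis.Complex_Analysis"
begin

definition mp_poly :: "nat \<Rightarrow> complex \<Rightarrow> complex" where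
  "mp_poly k x = (2 * x + of_nat k - 1) * (\<Prod>j = 1..k - 2. x + of_nat j) / fact (k - 1)"

(* The term for n+1 is added at index n, so the sum runs over all positive integers.
   The bases of the powers are positive reals, so powr is the principal power. *)
definition mp_series :: "nat \<Rightarrow> complex \<Rightarrow> complex" where
  "mp_series k s =
     (\<Sum>n. mp_poly k (2 * of_nat (Suc n)) /
        (2 * of_nat (Suc n) * (2 * of_nat (Suc n) + of_nat k - 1)) powr s)"

(* "Nicely" meromorphic: removable singularities are removed, so that off the poles the
   value of L is its analytic value; at a pole L is 0 by convention. *)
definition is_mp_zeta :: "nat \<Rightarrow> (complex \<Rightarrow> complex) \<Rightarrow> bool" where
  "is_mp_zeta k L \<longleftrightarrow>
     L nicely_meromorphic_on UNIV \<and>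
     (\<forall>s. is_pole L s \<longrightarrow> (\<exists>n::nat. s = of_nat k / 2 - of_nat n)) \<and>
     (\<forall>s. Re s > real k / 2 \<longrightarrow> L s = mp_series k s)"

lemma is_mp_zeta_unique:
  assumes "is_mp_zeta k f" "is_mp_zeta k g"
  shows "f = g"
proof -
  have nf: "f nicely_meromorphic_on UNIV" and ng: "g nicely_meromorphic_on UNIV"
    and eq: "\<And>s. Re s > real k / 2 \<Longrightarrow> f s = g s"
    using assms by (auto simp: is_mp_zeta_def)
  have mf: "f meromorphic_on UNIV" and mg: "g meromorphic_on UNIV"
    using nf ng by (auto simp: nicely_meromorphic_on_def)
  define s0 where "s0 = complex_of_real (real k / 2 + 1)"
  have "(\<forall>\<^sub>\<approx>x\<in>UNIV. f x - g x = 0) \<or> (\<forall>\<^sub>\<approx>x\<in>UNIV. f x - g x \<noteq> 0)"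
    by (intro meromorphic_imp_constant_or_avoid meromorphic_intros mf mg) auto
  moreover have "\<not> (\<forall>\<^sub>\<approx>x\<in>UNIV. f x - g x \<noteq> 0)"
  proof
    assume "\<forall>\<^sub>\<approx>x\<in>UNIV. f x - g x \<noteq> 0"
    then have "eventually (\<lambda>x. f x - g x \<noteq> 0) (at s0)"
      by (auto simp: eventually_cosparse_open_eq)
    moreover have "eventually (\<lambda>x. x \<in> {s. Re s > real k / 2}) (at s0)"
      by (intro eventually_at_in_open' open_halfspace_Re_gt) (auto simp: s0_def)
    ultimately have "eventually (\<lambda>x. False) (at s0)"
      by eventually_elim (use eq in auto)
    then show False by simp
  qed
  ultimately have ev: "\<forall>\<^sub>\<approx>x\<in>UNIV. f x - g x = 0" by blast
  show "f = g"
  proof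
    fix z
    have e: "eventually (\<lambda>x. f x = g x) (at z)"
      using ev by (auto simp: eventually_cosparse_open_eq)
    then have "is_pole f z \<longleftrightarrow> is_pole g z"
      by (intro is_pole_cong refl)
    moreover have "f \<midarrow>z\<rightarrow> l \<longleftrightarrow> g \<midarrow>z\<rightarrow> l" for l
      by (intro tendsto_cong e)
    moreover have "(is_pole f z \<and> f z = 0) \<or> f \<midarrow>z\<rightarrow> f z" "(is_pole g z \<and> g z = 0) \<or> g \<midarrow>z\<rightarrow> g z"
      using nf ng by (auto simp: nicely_meromorphic_on_def)
    ultimately show "f z = g z"
      by (metis LIM_unique not_tendsto_and_filterlim_at_infinity is_pole_def at_neq_bot)
  qed
qed

definition mp_zeta :: "nat \<Rightarrow> complex \<Rightarrow> complex" where
  "mp_zeta k = (THE L. is_mp_zeta k L)"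

end

theory Submission
  imports Defs
begin

text \<open>Write $k = 2m + 1$ and $y = 2n + m$. The summand of $L_k$ is $y^{2m - 2s}$ times a power series
  in $y^{-2}$ whose coefficients are entire in $s$. Its leading term can be peeled off with the
  symmetric difference $(y - 1)^{w+1} - (y + 1)^{w+1} = -2(w + 1) y^w (1 + O(y^{-2}))$, where
  $w = 2m - 2s$: the sum over $y \in m + 2 + 2\mathbb{N}$ telescopes to a boundary term, and the remaining
  summand has the same shape with the exponent lowered by 2. Iterating continues $L_k$ to
  $\mathbb{C}$, with poles only where $w + 1 - 2i = 0$.

  At $s = -n$ the summand is an even polynomial $R(y)$, and peeling ends with an odd polynomial $G$
  such that $R(y) = G(y - 1) - G(y + 1)$ and $L_k(-n) = G(m + 1)$. As $G$ is odd and $R$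
  vanishes at $0, \dots, m - 1$, also $G$ vanishes at $0, \dots, m$, so
  $L_k(-n) = -R(m) = -P_k(0) \cdot 0^n$.\<close>

section \<open>Power series with entire coefficients\<close>

text \<open>For \<open>norm w \<le> B\<close> every factor satisfies
  \<open>norm (w - i) \<le> B + i\<close>, so the binomial coefficient is dominated by that of the
  single exponent \<open>-B\<close>. The binomial series of that exponent converges at
  \<open>x\<close>, hence its terms are bounded.\<close>

lemma gbinomial_times_power_bounded:
  fixes x B :: real
  assumes "0 \<le> x" "x < 1"
  obtains C where "\<And>j (w::complex). norm w \<le> B \<Longrightarrow> norm (w gchoose j) * x ^ j \<le> C"
proof -
  have "(\<lambda>j. ((-B) gchoose j) * x ^ j) \<longlonglongrightarrow> 0"
    using gen_binomial_real[of x "-B"] assms by (intro summable_LIMSEQ_zero) (auto simp: sums_iff)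
  then have "Bseq (\<lambda>j. ((-B) gchoose j) * x ^ j)"
    by (intro convergent_imp_Bseq) (auto simp: convergent_def)
  then obtain C where C: "\<And>j. norm (((-B) gchoose j) * x ^ j) \<le> C"
    by (auto simp: Bseq_def)
  show ?thesis
  proof
    fix j and w :: complex
    assume w: "norm w \<le> B"
    then have "B \<ge> 0" using norm_ge_zero order_trans by blast
    have "norm (w gchoose j) = (\<Prod>i=0..<j. norm (w - of_nat i)) / fact j"
      by (simp add: gbinomial_prod_rev norm_divide prod_norm)
    also have "\<dots> \<le> (\<Prod>i=0..<j. \<bar>-B - real i\<bar>) / fact j"
    proof (intro divide_right_mono prod_mono conjI)
      fix i
      show "norm (w - of_nat i) \<le> \<bar>-B - real i\<bar>"
        using w norm_triangle_ineq4[of w "of_nat i"] \<open>B \<ge> 0\<close> by simp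
    qed auto
    also have "\<dots> = \<bar>(-B) gchoose j\<bar>"
      by (simp add: gbinomial_prod_rev abs_divide abs_prod)
    finally have "norm (w gchoose j) * x ^ j \<le> \<bar>(-B) gchoose j\<bar> * x ^ j"
      by (rule mult_right_mono) (use assms in auto)
    also have "\<dots> \<le> C"
      using C[of j] assms by (simp add: abs_mult)
    finally show "norm (w gchoose j) * x ^ j \<le> C" .
  qed
qed

text \<open>The M-test on small closed discs gives locally uniform convergence. It serves both the
  inner power series in \<open>1 / y\<^sup>2\<close> and the outer sum over the nodes.\<close>

lemma holomorphic_on_suminf_locally_dominated:
  fixes f :: "nat \<Rightarrow> complex \<Rightarrow> complex"
  assumes "open S" "\<And>n. f n holomorphic_on S"
    and "\<And>x. x \<in> S \<Longrightarrow> \<exists>d>0. \<exists>M. cball x d \<subseteq> S \<and> summable M \<and> (\<forall>n. \<forall>z\<in>cball x d. norm (f n z) \<le> M n)"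
  shows "(\<lambda>z. \<Sum>n. f n z) holomorphic_on S"
proof (rule holomorphic_uniform_sequence[OF \<open>open S\<close>, of "\<lambda>N z. \<Sum>n<N. f n z"])
  show "(\<lambda>z. \<Sum>n<N. f n z) holomorphic_on S" for N
    by (intro holomorphic_intros assms)
  fix x assume "x \<in> S"
  then obtain d M where d: "d > 0" "cball x d \<subseteq> S" "summable M"
    "\<And>n z. z \<in> cball x d \<Longrightarrow> norm (f n z) \<le> M n"
    using assms(3)[of x] by auto
  have "uniform_limit (cball x d) (\<lambda>N z. \<Sum>n<N. f n z) (\<lambda>z. \<Sum>n. f n z) sequentially"
    by (rule Weierstrass_m_test) (use d in auto)
  then show "\<exists>d>0. cball x d \<subseteq> S \<and>
      uniform_limit (cball x d) (\<lambda>N z. \<Sum>n<N. f n z) (\<lambda>z. \<Sum>n. f n z) sequentially"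
    using d by blast
qed

text \<open>Describes a power series in \<open>u\<close> with entire coefficients that converges for
  \<open>norm u < r\<close>, uniformly for \<open>s\<close> in bounded sets. Bounding the terms at
  radius \<open>r\<close> instead of asking for summability makes the condition survive the
  operations below with only the constant changing.\<close>

definition admissible :: "real \<Rightarrow> (nat \<Rightarrow> complex \<Rightarrow> complex) \<Rightarrow> bool" where
  "admissible r a \<longleftrightarrow> (\<forall>j. a j holomorphic_on UNIV) \<and>
     (\<forall>B. \<exists>C. \<forall>j s. norm s \<le> B \<longrightarrow> norm (a j s) * r ^ j \<le> C)"

lemma admissibleE:
  assumes "admissible r a" "r > 0"
  obtains C where "C > 0" "\<And>j s. norm s \<le> B \<Longrightarrow> norm (a j s) \<le> C * (1 / r) ^ j"
proof -
  obtain C where C: "\<And>j s. norm s \<le> B \<Longrightarrow> norm (a j s) * r ^ j \<le> C"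
    using assms unfolding admissible_def by metis
  show ?thesis
  proof
    show "max 1 C > 0" by simp
    fix j s assume "norm (s::complex) \<le> B"
    then have "norm (a j s) * r ^ j \<le> max 1 C" using C[of s j] by linarith
    then show "norm (a j s) \<le> max 1 C * (1 / r) ^ j"
      using \<open>r > 0\<close> by (simp add: field_simps)
  qed
qed

section \<open>Closure properties of admissible coefficient sequences\<close>

lemma admissible_add:
  assumes "admissible r a" "admissible r b" "r \<ge> 0"
  shows "admissible r (\<lambda>j s. a j s + b j s)"
  unfolding admissible_def
proof (intro conjI allI)
  show "(\<lambda>s. a j s + b j s) holomorphic_on UNIV" for j
    using assms by (auto simp: admissible_def intro: holomorphic_intros)
  fix B
  obtain C D where "\<And>j s. norm s \<le> B \<Longrightarrow> norm (a j s) * r ^ j \<le> C"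
    "\<And>j s. norm s \<le> B \<Longrightarrow> norm (b j s) * r ^ j \<le> D"
    using assms unfolding admissible_def by metis
  moreover have "norm (a j s + b j s) * r ^ j \<le> norm (a j s) * r ^ j + norm (b j s) * r ^ j" for j s
    using assms(3) mult_right_mono[OF norm_triangle_ineq, of "r ^ j" "a j s" "b j s"]
    by (simp add: distrib_right)
  ultimately show "\<exists>C. \<forall>j s. norm s \<le> B \<longrightarrow> norm (a j s + b j s) * r ^ j \<le> C"
    by (intro exI[of _ "C + D"]) (meson add_mono order_trans)
qed

lemma admissible_mult:
  assumes "admissible r a" "g holomorphic_on UNIV" "r \<ge> 0"
  shows "admissible r (\<lambda>j s. g s * a j s)"
  unfolding admissible_def
proof (intro conjI allI)
  show "(\<lambda>s. g s * a j s) holomorphic_on UNIV" for j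
    using assms by (auto simp: admissible_def intro: holomorphic_intros)
  fix B
  obtain C where C: "\<And>j s. norm s \<le> B \<Longrightarrow> norm (a j s) * r ^ j \<le> C"
    using assms unfolding admissible_def by metis
  \<comment> \<open>An entire factor is bounded on each closed disc, so it only enlarges the
    constant.\<close>
  have "compact (g ` cball 0 B)"
    by (intro compact_continuous_image holomorphic_on_imp_continuous_on
        holomorphic_on_subset[OF assms(2)]) auto
  then obtain D where D: "D > 0" "\<And>s. norm s \<le> B \<Longrightarrow> norm (g s) \<le> D"
    by (metis bounded_pos compact_imp_bounded image_eqI mem_cball_0)
  have "norm (g s * a j s) * r ^ j \<le> D * C" if "norm s \<le> B" for j s
    using mult_mono[OF D(2)[OF that] C[OF that, of j]] D(1) assms(3)
    by (simp add: norm_mult mult.assoc)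
  then show "\<exists>C. \<forall>j s. norm s \<le> B \<longrightarrow> norm (g s * a j s) * r ^ j \<le> C"
    by blast
qed

lemma admissible_Suc:
  assumes "admissible r a" "r > 0"
  shows "admissible r (\<lambda>j. a (Suc j))"
  unfolding admissible_def
proof (intro conjI allI)
  show "a (Suc j) holomorphic_on UNIV" for j
    using assms by (auto simp: admissible_def)
  fix B
  obtain C where C: "\<And>j s. norm s \<le> B \<Longrightarrow> norm (a j s) * r ^ j \<le> C"
    using assms unfolding admissible_def by metis
  have "norm (a (Suc j) s) * r ^ j \<le> C / r" if "norm s \<le> B" for j s
    using C[OF that, of "Suc j"] \<open>r > 0\<close> by (simp add: field_simps)
  then show "\<exists>C. \<forall>j s. norm s \<le> B \<longrightarrow> norm (a (Suc j) s) * r ^ j \<le> C"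
    by blast
qed

text \<open>These are the coefficients of the power series multiplied by its variable.\<close>

definition shift_right :: "(nat \<Rightarrow> complex \<Rightarrow> complex) \<Rightarrow> nat \<Rightarrow> complex \<Rightarrow> complex" where
  "shift_right a j s = (case j of 0 \<Rightarrow> 0 | Suc i \<Rightarrow> a i s)"

lemma admissible_shift_right:
  assumes "admissible r a" "r > 0"
  shows "admissible r (shift_right a)"
  unfolding admissible_def
proof (intro conjI allI)
  show "shift_right a j holomorphic_on UNIV" for j
    using assms by (cases j) (auto simp: admissible_def shift_right_def[abs_def])
  fix B
  obtain C where C: "\<And>j s. norm s \<le> B \<Longrightarrow> norm (a j s) * r ^ j \<le> C"
    using assms unfolding admissible_def by metis
  have "norm (shift_right a j s) * r ^ j \<le> max 0 (C * r)" if "norm s \<le> B" for j s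
    using mult_right_mono[OF C[OF that], of r "j - 1"] \<open>r > 0\<close>
    by (cases j) (auto simp: shift_right_def mult_ac max.coboundedI2)
  then show "\<exists>C. \<forall>j s. norm s \<le> B \<longrightarrow> norm (shift_right a j s) * r ^ j \<le> C"
    by blast
qed

text \<open>These are the coefficients of \<open>(1 + c * u) powr g s\<close>; the condition on
  \<open>r\<close> keeps the disc inside the radius of convergence.\<close>

lemma admissible_gbinomial:
  assumes "g holomorphic_on UNIV" "\<bar>c\<bar> * r < 1" "r > 0"
  shows "admissible r (\<lambda>j s. (g s gchoose j) * of_real c ^ j)"
  unfolding admissible_def
proof (intro conjI allI)
  have "(\<lambda>s. (\<Prod>i = 0..<j. g s - of_nat i) / fact j * of_real c ^ j) holomorphic_on UNIV" for j
    by (intro holomorphic_intros assms) auto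
  then show "(\<lambda>s. (g s gchoose j) * of_real c ^ j) holomorphic_on UNIV" for j
    by (simp add: gbinomial_prod_rev)
  fix B
  have "compact (g ` cball 0 B)"
    by (intro compact_continuous_image holomorphic_on_imp_continuous_on
        holomorphic_on_subset[OF assms(1)]) auto
  then obtain D where D: "\<And>s. norm s \<le> B \<Longrightarrow> norm (g s) \<le> D"
    by (metis bounded_pos compact_imp_bounded image_eqI mem_cball_0)
  obtain C where C: "\<And>j (w::complex). norm w \<le> D \<Longrightarrow> norm (w gchoose j) * (\<bar>c\<bar> * r) ^ j \<le> C"
    by (rule gbinomial_times_power_bounded[of "\<bar>c\<bar> * r" D]) (use assms in auto)
  have "norm ((g s gchoose j) * of_real c ^ j) * r ^ j \<le> C" if "norm s \<le> B" for j s
    using C[OF D[OF that], of j] by (simp add: norm_mult norm_power power_mult_distrib mult_ac)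
  then show "\<exists>C. \<forall>j s. norm s \<le> B \<longrightarrow> norm ((g s gchoose j) * of_real c ^ j) * r ^ j \<le> C"
    by blast
qed

text \<open>With \<open>u = v\<^sup>2\<close>, radius \<open>r\<close> in \<open>u\<close> is radius
  \<open>sqrt r\<close> in \<open>v\<close>, where the plain binomial coefficients are admissible;
  dividing by \<open>2 * j + 1\<close> only helps. This is the series that occurs in the symmetric
  difference of powers.\<close>

lemma admissible_gbinomial_even:
  assumes "g holomorphic_on UNIV" "r < 1" "r > 0"
  shows "admissible r (\<lambda>j s. (g s gchoose (2 * j)) / of_nat (2 * j + 1))"
proof -
  have adm: "admissible (sqrt r) (\<lambda>j s. (g s gchoose j) * of_real 1 ^ j)"
    by (rule admissible_gbinomial) (use assms in auto)
  show ?thesis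
    unfolding admissible_def
  proof (intro conjI allI)
    have "(\<lambda>s. (\<Prod>i = 0..<2*j. g s - of_nat i) / fact (2*j) / of_nat (2*j+1)) holomorphic_on UNIV" for j
      by (intro holomorphic_intros assms) (auto simp del: of_nat_Suc of_nat_add)
    then show "(\<lambda>s. (g s gchoose (2*j)) / of_nat (2 * j + 1)) holomorphic_on UNIV" for j
      by (simp add: gbinomial_prod_rev)
    fix B
    obtain C where C: "\<And>j s. norm s \<le> B \<Longrightarrow> norm (g s gchoose j) * sqrt r ^ j \<le> C"
      using adm unfolding admissible_def by (auto simp: norm_mult) metis
    have "norm ((g s gchoose (2*j)) / of_nat (2*j+1)) * r ^ j \<le> C" if "norm s \<le> B" for j s
    proof -
      have "norm ((g s gchoose (2*j)) / of_nat (2*j+1)) \<le> norm (g s gchoose (2*j))"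
        by (simp add: norm_divide divide_le_eq mult_le_cancel_left1 del: of_nat_Suc of_nat_add)
      then have "norm ((g s gchoose (2*j)) / of_nat (2*j+1)) * r ^ j \<le> norm (g s gchoose (2*j)) * r ^ j"
        by (rule mult_right_mono) (use assms in auto)
      also have "\<dots> = norm (g s gchoose (2*j)) * sqrt r ^ (2*j)"
        using assms by (simp add: power_mult)
      finally show ?thesis using C[OF that, of "2*j"] by linarith
    qed
    then show "\<exists>C. \<forall>j s. norm s \<le> B \<longrightarrow> norm ((g s gchoose (2*j)) / of_nat (2*j+1)) * r ^ j \<le> C"
      by blast
  qed
qed

section \<open>Convergence, bounds and holomorphy of the power series\<close>

lemma admissible_norm_summable:
  assumes "admissible r a" "norm u < r"
  shows "summable (\<lambda>j. norm (a j s * u ^ j))"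
proof -
  have r: "r > 0" using assms(2) norm_ge_zero[of u] by linarith
  obtain C where C: "C > 0" "\<And>j. norm (a j s) \<le> C * (1 / r) ^ j"
    using admissibleE[OF assms(1) r, of "norm s"] by (metis order_refl)
  have "summable (\<lambda>j. C * (norm u / r) ^ j)"
    using assms(2) r by (intro summable_mult summable_geometric) (auto simp: divide_simps)
  then show ?thesis
  proof (rule summable_comparison_test'[where N = 0])
    show "norm (norm (a j s * u ^ j)) \<le> C * (norm u / r) ^ j" for j
      using mult_right_mono[OF C(2)[of j], of "norm u ^ j"]
      by (simp add: norm_mult norm_power power_divide)
  qed
qed

lemma admissible_summable:
  "admissible r a \<Longrightarrow> norm u < r \<Longrightarrow> summable (\<lambda>j. a j s * u ^ j)"
  by (rule summable_norm_cancel[OF admissible_norm_summable])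

lemma admissible_suminf_bound:
  assumes "admissible r a" "0 \<le> t" "t < r"
  obtains C where "C > 0" "\<And>s u. norm s \<le> B \<Longrightarrow> norm u \<le> t \<Longrightarrow> norm (\<Sum>j. a j s * u ^ j) \<le> C"
proof -
  have r: "r > 0" using assms by linarith
  obtain C where C: "C > 0" "\<And>j s. norm s \<le> B \<Longrightarrow> norm (a j s) \<le> C * (1 / r) ^ j"
    using admissibleE[OF assms(1) r, of B] by metis
  have su: "summable (\<lambda>j. C * (t / r) ^ j)"
    using assms r by (intro summable_mult summable_geometric) auto
  show ?thesis
  proof
    \<comment> \<open>Adding 1 gives strict positivity without inspecting the sum.\<close>
    show "(\<Sum>j. C * (t / r) ^ j) + 1 > 0"
      by (intro add_nonneg_pos suminf_nonneg su) (use C assms in auto)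
    fix s u :: complex assume s: "norm s \<le> B" and u: "norm u \<le> t"
    have *: "norm (a j s * u ^ j) \<le> C * (t / r) ^ j" for j
    proof -
      have "norm (a j s * u ^ j) \<le> (C * (1 / r) ^ j) * t ^ j"
        unfolding norm_mult norm_power
        by (intro mult_mono C s power_mono u) (use C r in auto)
      then show ?thesis by (simp add: power_divide)
    qed
    have "norm (\<Sum>j. a j s * u ^ j) \<le> (\<Sum>j. C * (t / r) ^ j)"
      using * su by (rule norm_suminf_le)
    then show "norm (\<Sum>j. a j s * u ^ j) \<le> (\<Sum>j. C * (t / r) ^ j) + 1" by simp
  qed
qed

lemma admissible_suminf_holomorphic:
  assumes "admissible r a" "norm u < r"
  shows "(\<lambda>s. \<Sum>j. a j s * u ^ j) holomorphic_on UNIV"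
proof (rule holomorphic_on_suminf_locally_dominated)
  show "(\<lambda>s. a j s * u ^ j) holomorphic_on UNIV" for j
    using assms by (auto simp: admissible_def intro!: holomorphic_intros)
  fix x :: complex
  have r: "r > 0" using assms(2) norm_ge_zero[of u] by linarith
  obtain C where C: "C > 0" "\<And>j s. norm s \<le> norm x + 1 \<Longrightarrow> norm (a j s) \<le> C * (1 / r) ^ j"
    using admissibleE[OF assms(1) r, of "norm x + 1"] by metis
  have "summable (\<lambda>j. C * (norm u / r) ^ j)"
    using assms(2) r by (intro summable_mult summable_geometric) (auto simp: divide_simps)
  moreover have "norm (a j z * u ^ j) \<le> C * (norm u / r) ^ j" if "z \<in> cball x 1" for j z
  proof -
    have "norm z \<le> norm x + 1"
      using that norm_triangle_ineq4[of x "x - z"] by (simp add: dist_norm)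
    then show ?thesis
      using mult_right_mono[OF C(2)[of z j], of "norm u ^ j"]
      by (simp add: norm_mult norm_power power_divide)
  qed
  ultimately show "\<exists>d>0. \<exists>M. cball x d \<subseteq> UNIV \<and> summable M \<and>
      (\<forall>n. \<forall>z\<in>cball x d. norm (a n z * u ^ n) \<le> M n)"
    by (intro exI[of _ 1] conjI exI[of _ "\<lambda>j. C * (norm u / r) ^ j"]) auto
qed auto

section \<open>Peeling off the leading term\<close>

text \<open>Both powers are expanded by the binomial series around \<open>y\<close>. Even orders
  cancel, odd orders double, and the absorption identity turns
  \<open>(w + 1) gchoose (2*j + 1)\<close> into \<open>(w + 1) / (2*j + 1)\<close> times
  \<open>w gchoose (2*j)\<close>.\<close>

lemma shifted_powr_difference:
  fixes y :: real and w :: complex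
  assumes "y > 1"
  shows "of_real (y - 1) powr (w + 1) - of_real (y + 1) powr (w + 1) =
    -2 * (w + 1) * of_real y powr w * (\<Sum>j. (w gchoose (2*j)) / of_nat (2*j+1) * of_real (1 / y\<^sup>2) ^ j)"
proof -
  define f where "f = (\<lambda>n. ((w+1) gchoose n) * of_real y powr ((w+1) - of_nat n) * of_real (-1) ^ n
      - ((w+1) gchoose n) * of_real y powr ((w+1) - of_nat n) * of_real 1 ^ n)"
  define b where "b = (\<lambda>j. (w gchoose (2*j)) / of_nat (2*j+1) * of_real (1 / y\<^sup>2) ^ j)"
  have "f sums (of_real (y + (-1)) powr (w+1) - of_real (y + 1) powr (w+1))"
    unfolding f_def using assms by (intro sums_diff gen_binomial_complex'') auto
  also have "?this \<longleftrightarrow> (\<lambda>j. f (2*j+1)) sums (of_real (y + (-1)) powr (w+1) - of_real (y + 1) powr (w+1))"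
  proof (rule sums_mono_reindex[symmetric])
    show "strict_mono (\<lambda>j::nat. 2*j+1)" by (auto simp: strict_mono_def)
    show "f n = 0" if "n \<notin> range (\<lambda>j::nat. 2*j+1)" for n
    proof -
      have "even n" using that by (metis oddE rangeI)
      then show ?thesis by (simp add: f_def)
    qed
  qed
  also have "(\<lambda>j. f (2*j+1)) = (\<lambda>j. -2 * (w + 1) * of_real y powr w * b j)"
  proof
    fix j
    have "of_real y powr ((w+1) - of_nat (2*j+1)) = of_real y powr w * of_real (1 / y\<^sup>2) ^ j"
    proof -
      have "of_real y powr ((w+1) - of_nat (2*j+1)) = of_real y powr (w - of_nat (2*j))" by simp
      also have "\<dots> = of_real y powr w / of_real y powr of_nat (2*j)" by (rule powr_diff)
      also have "of_real y powr of_nat (2*j) = (of_real y ^ (2*j) :: complex)"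
        using assms by (subst powr_nat') auto
      finally show ?thesis by (simp add: power_mult power_divide)
    qed
    moreover have "(w+1) gchoose (2*j+1) = (w + 1) * ((w gchoose (2*j)) / of_nat (2*j+1))"
      using gbinomial_factors[of w "2*j"] by simp
    moreover have "f (2*j+1) = -2 * ((w+1) gchoose (2*j+1)) * of_real y powr ((w+1) - of_nat (2*j+1))"
      by (simp add: f_def)
    ultimately show "f (2*j+1) = -2 * (w + 1) * of_real y powr w * b j"
      by (simp only: b_def mult_ac)
  qed
  finally have s: "(\<lambda>j. -2 * (w + 1) * of_real y powr w * b j) sums
      (of_real (y - 1) powr (w+1) - of_real (y + 1) powr (w+1))" by simp
  \<comment> \<open>For \<open>w = -1\<close> both sides are zero. Otherwise the prefactor is
    nonzero, so summability of \<open>b\<close> can be read off from the scaled series.\<close>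
  show ?thesis
  proof (cases "w + 1 = 0")
    case True
    then show ?thesis using assms by (simp del: of_real_add of_real_diff)
  next
    case False
    then have "-2 * (w + 1) * of_real y powr w \<noteq> 0"
      using assms by (subst mult_eq_0_iff, subst mult_eq_0_iff) simp
    then have "summable b" using s summable_mult_D sums_summable by blast
    then show ?thesis
      using s suminf_mult[of b "-2 * (w + 1) * of_real y powr w"] by (simp add: sums_iff b_def)
  qed
qed

definition expansion_term :: "complex \<Rightarrow> (nat \<Rightarrow> complex \<Rightarrow> complex) \<Rightarrow> real \<Rightarrow> complex \<Rightarrow> complex" where
  "expansion_term p a y s = of_real y powr (p - 2 * s) * (\<Sum>j. a j s * of_real (1 / y\<^sup>2) ^ j)"

text \<open>If \<open>A\<close> is the series of \<open>a\<close> and \<open>B\<close> the series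
  from the symmetric difference, these are the coefficients of \<open>(A - a 0 s * B) / u\<close>.
  The division is possible because \<open>B\<close> has constant term 1.\<close>

definition peel :: "complex \<Rightarrow> (nat \<Rightarrow> complex \<Rightarrow> complex) \<Rightarrow> nat \<Rightarrow> complex \<Rightarrow> complex" where
  "peel p a j s = a (Suc j) s - a 0 s * (((p - 2 * s) gchoose (2 * Suc j)) / of_nat (2 * Suc j + 1))"

lemma admissible_peel:
  assumes "admissible r a" "0 < r" "r < 1"
  shows "admissible r (peel p a)"
proof -
  have "(\<lambda>s. - a 0 s) holomorphic_on UNIV"
    using assms by (auto simp: admissible_def intro: holomorphic_intros)
  moreover have "admissible r (\<lambda>j s. ((p - 2 * s) gchoose (2 * j)) / of_nat (2 * j + 1))"
    using assms by (intro admissible_gbinomial_even holomorphic_intros)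
  ultimately have "admissible r (\<lambda>j s. a (Suc j) s +
      (- a 0 s) * (((p - 2 * s) gchoose (2 * Suc j)) / of_nat (2 * Suc j + 1)))"
    using assms by (intro admissible_add[OF admissible_Suc admissible_mult[OF admissible_Suc]]) auto
  then show ?thesis by (simp add: peel_def[abs_def])
qed

text \<open>Writing \<open>A = a 0 s * B + u * A'\<close>, where \<open>A'\<close> is the series of
  the peeled coefficients, the part with \<open>B\<close> is the symmetric difference divided by
  \<open>2 * (2 * s - p - 1)\<close>. The assumption \<open>ne\<close> makes that division
  legitimate.\<close>

lemma expansion_term_peel:
  assumes a: "admissible r a" and r: "r < 1" "1 / y\<^sup>2 < r" and y: "y > 1"
    and ne: "2 * s - p - 1 \<noteq> 0"
  shows "expansion_term p a y s =
    a 0 s / (2 * (2 * s - p - 1)) * (of_real (y - 1) powr (p + 1 - 2 * s) - of_real (y + 1) powr (p + 1 - 2 * s))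
    + expansion_term (p - 2) (peel p a) y s"
proof -
  define u :: complex where "u = of_real (1 / y\<^sup>2)"
  define w where "w = p - 2 * s"
  define b where "b = (\<lambda>j. (w gchoose (2*j)) / of_nat (2*j+1))"
  have nu: "norm u < r" and r0: "r > 0"
    using r y by (auto simp: u_def norm_divide norm_power intro: less_trans[of 0 "1 / y\<^sup>2"])
  have "admissible r (\<lambda>j s. ((p - 2 * s) gchoose (2*j)) / of_nat (2*j+1))"
    using r r0 by (intro admissible_gbinomial_even holomorphic_intros)
  from admissible_summable[OF this nu, of s] have sb: "summable (\<lambda>j. b j * u ^ j)"
    by (simp add: b_def w_def)
  have sa: "summable (\<lambda>j. a j s * u ^ j)" by (rule admissible_summable[OF a nu])
  have sp: "summable (\<lambda>j. peel p a j s * u ^ j)"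
    by (rule admissible_summable[OF admissible_peel[OF a r0 r(1)] nu])
  define f where "f = (\<lambda>j. a j s * u ^ j - a 0 s * (b j * u ^ j))"
  have "f sums ((\<Sum>j. a j s * u ^ j) - a 0 s * (\<Sum>j. b j * u ^ j))"
    unfolding f_def by (intro sums_diff sums_mult summable_sums sa sb)
  moreover have "f 0 = 0"
    by (simp add: f_def b_def)
  ultimately have "(\<lambda>j. f (Suc j)) sums ((\<Sum>j. a j s * u ^ j) - a 0 s * (\<Sum>j. b j * u ^ j))"
    by (simp add: sums_Suc_iff)
  moreover have "(\<lambda>j. f (Suc j)) = (\<lambda>j. u * (peel p a j s * u ^ j))"
    by (rule ext) (simp add: f_def peel_def b_def w_def algebra_simps)
  ultimately have "(\<lambda>j. u * (peel p a j s * u ^ j)) sums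
      ((\<Sum>j. a j s * u ^ j) - a 0 s * (\<Sum>j. b j * u ^ j))" by simp
  moreover have "(\<lambda>j. u * (peel p a j s * u ^ j)) sums (u * (\<Sum>j. peel p a j s * u ^ j))"
    by (intro sums_mult summable_sums sp)
  ultimately have "(\<Sum>j. a j s * u ^ j) - a 0 s * (\<Sum>j. b j * u ^ j) =
      u * (\<Sum>j. peel p a j s * u ^ j)"
    by (rule sums_unique2)
  then have *: "(\<Sum>j. a j s * u ^ j) =
      a 0 s * (\<Sum>j. b j * u ^ j) + u * (\<Sum>j. peel p a j s * u ^ j)"
    by (simp add: algebra_simps)
  \<comment> \<open>The factor \<open>u\<close> left over from the division lowers the exponent by
    2, which restores the shape of an expansion term.\<close>
  have wu: "of_real y powr w * u = of_real y powr (p - 2 - 2 * s)"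
  proof -
    have "of_real y powr (p - 2 - 2 * s) = of_real y powr (w - of_nat 2)"
      by (simp add: w_def algebra_simps)
    also have "\<dots> = of_real y powr w / of_real y powr of_nat 2" by (rule powr_diff)
    also have "of_real y powr of_nat 2 = (of_real y ^ 2 :: complex)"
      using y by (subst powr_nat') auto
    finally show ?thesis by (simp add: u_def)
  qed
  have D: "of_real (y - 1) powr (p + 1 - 2 * s) - of_real (y + 1) powr (p + 1 - 2 * s) =
      2 * (2 * s - p - 1) * (of_real y powr w * (\<Sum>j. b j * u ^ j))"
    using shifted_powr_difference[OF y, of w]
    by (simp add: w_def b_def u_def algebra_simps)
  have ne2: "2 * (2 * s - p - 1) \<noteq> 0" using ne by (metis mult_eq_0_iff zero_neq_numeral)
  have "expansion_term p a y s = of_real y powr w *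
      (a 0 s * (\<Sum>j. b j * u ^ j) + u * (\<Sum>j. peel p a j s * u ^ j))"
    unfolding expansion_term_def w_def[symmetric] u_def[symmetric] * ..
  also have "\<dots> = a 0 s * (of_real y powr w * (\<Sum>j. b j * u ^ j))
      + (of_real y powr w * u) * (\<Sum>j. peel p a j s * u ^ j)"
    by (simp add: algebra_simps)
  also have "a 0 s * (of_real y powr w * (\<Sum>j. b j * u ^ j)) =
      a 0 s / (2 * (2 * s - p - 1)) * (2 * (2 * s - p - 1) * (of_real y powr w * (\<Sum>j. b j * u ^ j)))"
    using ne2 by simp
  finally show ?thesis
    unfolding D wu[symmetric] expansion_term_def u_def[symmetric] .
qed

lemma expansion_term_holomorphic:
  assumes "admissible r a" "1 / y\<^sup>2 < r" "y > 0"
  shows "expansion_term p a y holomorphic_on UNIV"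
proof -
  have "(\<lambda>s. of_real y powr (p - 2 * s) * (\<Sum>j. a j s * of_real (1 / y\<^sup>2) ^ j)) holomorphic_on UNIV"
    using assms by (intro holomorphic_intros admissible_suminf_holomorphic[OF assms(1)])
      (auto simp: norm_divide norm_power)
  then show ?thesis by (simp add: expansion_term_def[abs_def])
qed

section \<open>Sums of expansion terms over an arithmetic progression\<close>

locale arithmetic_progression =
  fixes c r :: real
  assumes c_pos: "c > 0" and r_less: "r < 1" and r_gt: "1 / (c + 1)\<^sup>2 < r"
begin

text \<open>The step 2 makes \<open>node n + 1\<close> equal to \<open>node (Suc n) - 1\<close>, so
  symmetric differences telescope down to the point \<open>c\<close>. Since \<open>c + 1\<close> is
  the smallest node, the locale assumption on \<open>r\<close> puts all
  \<open>1 / (node n)\<^sup>2\<close> inside the disc of convergence.\<close>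

abbreviation node :: "nat \<Rightarrow> real" where
  "node n \<equiv> c + 1 + 2 * real n"

lemma node_gt_1: "node n > 1"
  using c_pos by simp

lemma node_ge: "node n \<ge> real (Suc n)"
  using c_pos by simp

lemma inverse_node_le: "1 / (node n)\<^sup>2 \<le> 1 / (c + 1)\<^sup>2"
  using c_pos by (intro divide_left_mono power_mono) auto

lemma inverse_node_less: "1 / (node n)\<^sup>2 < r"
  using inverse_node_le r_gt by (rule le_less_trans)

lemma r_pos: "r > 0"
  using r_gt by (smt (verit) zero_le_divide_1_iff zero_le_power2)

definition expansion_sum :: "complex \<Rightarrow> (nat \<Rightarrow> complex \<Rightarrow> complex) \<Rightarrow> complex \<Rightarrow> complex" where
  "expansion_sum p a s = (\<Sum>n. expansion_term p a (node n) s)"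

text \<open>The inner series is bounded uniformly, and the power has norm at most
  \<open>node n powr (-1 - \<epsilon>)\<close>. The resulting majorant does not depend on
  \<open>s\<close>, as the M-test requires.\<close>

lemma expansion_term_bound:
  assumes "admissible r a" "\<epsilon> > 0"
  obtains C where "\<And>n s. norm s \<le> B \<Longrightarrow> 2 * Re s \<ge> Re p + 1 + \<epsilon> \<Longrightarrow>
    norm (expansion_term p a (node n) s) \<le> C * real (Suc n) powr (- 1 - \<epsilon>)"
proof -
  obtain C where C: "C > 0" "\<And>s u. norm s \<le> B \<Longrightarrow> norm u \<le> 1 / (c + 1)\<^sup>2 \<Longrightarrow>
      norm (\<Sum>j. a j s * u ^ j) \<le> C"
    using admissible_suminf_bound[OF assms(1) _ r_gt, of B] by auto
  show ?thesis
  proof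
    fix n and s :: complex
    assume s: "norm s \<le> B" "2 * Re s \<ge> Re p + 1 + \<epsilon>"
    have "norm (of_real (node n) powr (p - 2 * s)) = node n powr (Re p - 2 * Re s)"
      using node_gt_1[of n] by (subst norm_powr_real_powr) auto
    also have "\<dots> \<le> node n powr (- 1 - \<epsilon>)"
      using node_gt_1[of n] s(2) by (intro powr_mono) auto
    also have "\<dots> \<le> real (Suc n) powr (- 1 - \<epsilon>)"
      using node_ge[of n] assms(2) by (intro powr_mono2') auto
    finally have "norm (of_real (node n) powr (p - 2 * s)) \<le> real (Suc n) powr (- 1 - \<epsilon>)" .
    moreover have "norm (\<Sum>j. a j s * of_real (1 / (node n)\<^sup>2) ^ j) \<le> C"
      using inverse_node_le[of n] by (intro C(2) s(1)) (subst norm_of_real, simp)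
    ultimately show "norm (expansion_term p a (node n) s) \<le> C * real (Suc n) powr (- 1 - \<epsilon>)"
      unfolding expansion_term_def norm_mult
      by (subst mult.commute) (intro mult_mono, use C in auto)
  qed
qed

lemma summable_Suc_powr: "\<epsilon> > 0 \<Longrightarrow> summable (\<lambda>n. C * real (Suc n) powr (- 1 - \<epsilon>))"
  by (subst summable_Suc_iff[of "\<lambda>n. C * real n powr (- 1 - \<epsilon>)"])
     (auto intro!: summable_mult simp: summable_real_powr_iff)

lemma expansion_term_summable:
  assumes "admissible r a" "2 * Re s > Re p + 1"
  shows "summable (\<lambda>n. expansion_term p a (node n) s)"
proof -
  define \<epsilon> where "\<epsilon> = 2 * Re s - Re p - 1"
  have e: "\<epsilon> > 0" using assms by (simp add: \<epsilon>_def)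
  obtain C where C: "\<And>n. norm (expansion_term p a (node n) s) \<le> C * real (Suc n) powr (- 1 - \<epsilon>)"
  proof (rule expansion_term_bound[OF assms(1) e, of "norm s" p])
    fix C assume "\<And>n z. norm z \<le> norm s \<Longrightarrow> 2 * Re z \<ge> Re p + 1 + \<epsilon> \<Longrightarrow>
      norm (expansion_term p a (node n) z) \<le> C * real (Suc n) powr (- 1 - \<epsilon>)"
    from this[of s] show thesis by (intro that[of C]) (simp add: \<epsilon>_def)
  qed
  show ?thesis
    by (rule summable_comparison_test'[OF summable_Suc_powr[OF e, of C], of 0]) (rule C)
qed

lemma expansion_sum_holomorphic:
  assumes "admissible r a"
  shows "expansion_sum p a holomorphic_on {s. 2 * Re s > Re p + 1}"
  unfolding expansion_sum_def[abs_def]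
proof (rule holomorphic_on_suminf_locally_dominated)
  have "{s. 2 * Re s > Re p + 1} = {s. Re s > (Re p + 1) / 2}" by auto
  then show "open {s. 2 * Re s > Re p + 1}" by (metis open_halfspace_Re_gt)
  show "expansion_term p a (node n) holomorphic_on {s. 2 * Re s > Re p + 1}" for n
    using node_gt_1[of n] inverse_node_less[of n]
    by (intro holomorphic_on_subset[OF expansion_term_holomorphic[OF assms]]) auto
  fix x assume "x \<in> {s. 2 * Re s > Re p + 1}"
  then have x: "2 * Re x > Re p + 1" by simp
  \<comment> \<open>A quarter of the margin: on the disc of radius \<open>d\<close>,
    \<open>2 * Re z\<close> drops by at most \<open>2 * d\<close>, so a margin of
    \<open>2 * d\<close> remains.\<close>
  define d where "d = (2 * Re x - Re p - 1) / 4"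
  have d: "d > 0" "2 * d > 0" using x by (simp_all add: d_def)
  obtain C where C: "\<And>n s. norm s \<le> norm x + d \<Longrightarrow> 2 * Re s \<ge> Re p + 1 + 2 * d \<Longrightarrow>
      norm (expansion_term p a (node n) s) \<le> C * real (Suc n) powr (- 1 - 2 * d)"
    using expansion_term_bound[OF assms d(2)] by metis
  have z: "norm z \<le> norm x + d" "2 * Re z \<ge> Re p + 1 + 2 * d" if "z \<in> cball x d" for z
  proof -
    have "norm (x - z) \<le> d" using that by (simp add: dist_norm)
    then show "norm z \<le> norm x + d" using norm_triangle_ineq4[of x "x - z"] by simp
    have "Re x - Re z \<le> d" using \<open>norm (x - z) \<le> d\<close> complex_Re_le_cmod[of "x - z"] by simp
    then show "2 * Re z \<ge> Re p + 1 + 2 * d" by (simp add: d_def field_simps)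
  qed
  show "\<exists>d>0. \<exists>M. cball x d \<subseteq> {s. 2 * Re s > Re p + 1} \<and> summable M \<and>
      (\<forall>n. \<forall>z\<in>cball x d. norm (expansion_term p a (node n) z) \<le> M n)"
  proof (intro exI[of _ d] conjI exI[of _ "\<lambda>n. C * real (Suc n) powr (- 1 - 2 * d)"] allI ballI d)
    show "cball x d \<subseteq> {s. 2 * Re s > Re p + 1}" using z(2) d(1) by fastforce
    show "summable (\<lambda>n. C * real (Suc n) powr (- 1 - 2 * d))" by (rule summable_Suc_powr[OF d(2)])
    show "norm (expansion_term p a (node n) z) \<le> C * real (Suc n) powr (- 1 - 2 * d)"
      if "z \<in> cball x d" for n z
      by (rule C) (use z[OF that] in auto)
  qed
qed

text \<open>This is what the telescoping sum leaves at \<open>c\<close>. Its denominator is the only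
  source of poles.\<close>

definition boundary_term :: "complex \<Rightarrow> (nat \<Rightarrow> complex \<Rightarrow> complex) \<Rightarrow> complex \<Rightarrow> complex" where
  "boundary_term p a s = a 0 s / (2 * (2 * s - p - 1)) * of_real c powr (p + 1 - 2 * s)"

lemma expansion_sum_peel:
  assumes a: "admissible r a" and s: "2 * Re s > Re p + 1"
  shows "expansion_sum p a s = boundary_term p a s + expansion_sum (p - 2) (peel p a) s"
proof -
  define g where "g = (\<lambda>n. of_real (c + 2 * real n) powr (p + 1 - 2 * s) :: complex)"
  define \<kappa> where "\<kappa> = a 0 s / (2 * (2 * s - p - 1))"
  have "(\<lambda>n. norm (g n)) = (\<lambda>n. (c + 2 * real n) powr (Re p + 1 - 2 * Re s))"
    using c_pos by (intro ext) (simp add: g_def norm_powr_real_powr add_pos_nonneg)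
  moreover have "filterlim (\<lambda>n. c + 2 * real n) at_top sequentially"
    by (intro filterlim_tendsto_add_at_top[OF tendsto_const]
        filterlim_tendsto_pos_mult_at_top[OF tendsto_const] filterlim_real_sequentially) auto
  then have "(\<lambda>n. (c + 2 * real n) powr (Re p + 1 - 2 * Re s)) \<longlonglongrightarrow> 0"
    using s by (intro tendsto_neg_powr) auto
  \<comment> \<open>The exponent of \<open>g\<close> has negative real part, so the far end of the
    telescoping sum contributes nothing.\<close>
  ultimately have "g \<longlonglongrightarrow> 0" by (intro tendsto_norm_zero_cancel[of g]) simp
  then have tel: "(\<lambda>n. \<kappa> * (g n - g (Suc n))) sums (\<kappa> * (g 0 - 0))"
    by (intro sums_mult telescope_sums')
  have "2 * s - p - 1 \<noteq> 0"
  proof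
    assume "2 * s - p - 1 = 0"
    then have "Re (2 * s - p - 1) = 0" by simp
    then show False using s by simp
  qed
  then have et: "expansion_term p a (node n) s =
      \<kappa> * (g n - g (Suc n)) + expansion_term (p - 2) (peel p a) (node n) s" for n
    using expansion_term_peel[OF a r_less inverse_node_less[of n] node_gt_1[of n], of s p]
    by (simp add: \<kappa>_def g_def algebra_simps)
  have "(\<lambda>n. expansion_term (p - 2) (peel p a) (node n) s) sums expansion_sum (p - 2) (peel p a) s"
    unfolding expansion_sum_def using s
    by (intro summable_sums expansion_term_summable admissible_peel a r_pos r_less) auto
  from sums_add[OF tel this] have "(\<lambda>n. expansion_term p a (node n) s) sums
      (\<kappa> * (g 0 - 0) + expansion_sum (p - 2) (peel p a) s)"
    unfolding et .
  then show ?thesis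
    by (simp add: expansion_sum_def sums_iff boundary_term_def \<kappa>_def g_def)
qed

end

section \<open>Continuation by repeated peeling\<close>

primrec peel_iter :: "complex \<Rightarrow> (nat \<Rightarrow> complex \<Rightarrow> complex) \<Rightarrow> nat \<Rightarrow> nat \<Rightarrow> complex \<Rightarrow> complex" where
  "peel_iter p a 0 = a"
| "peel_iter p a (Suc N) = peel (p - 2 * of_nat N) (peel_iter p a N)"

lemma admissible_peel_iter:
  assumes "admissible r a" "0 < r" "r < 1"
  shows "admissible r (peel_iter p a N)"
  by (induction N) (auto intro: admissible_peel assms)

text \<open>A nonconstant polynomial is unbounded along any path to infinity, and a constant with
  limit 0 is 0.\<close>

lemma poly_eq_0_if_tendsto_0:
  fixes q :: "complex poly"
  assumes "filterlim x at_infinity F" "((\<lambda>n. poly q (x n)) \<longlongrightarrow> 0) F" "F \<noteq> bot"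
  shows "q = 0"
proof (cases "degree q = 0")
  case True
  then obtain c where "q = [:c:]" by (rule degree_eq_zeroE)
  then show ?thesis using assms(2,3) by (simp add: tendsto_const_iff)
next
  case False
  then have "filterlim (\<lambda>n. poly q (x n)) at_infinity F"
    by (intro filterlim_compose[OF filterlim_poly_at_infinity assms(1)]) auto
  then show ?thesis
    using assms(2,3) not_tendsto_and_filterlim_at_infinity by blast
qed

section \<open>Gluing the stages into one meromorphic function\<close>

context arithmetic_progression
begin

text \<open>Stage \<open>N\<close> of the continuation: the remaining sum converges for
  \<open>2 * Re s > Re p + 1 - 2 * N\<close>, a half-plane that grows with \<open>N\<close>.\<close>

definition partial_continuation :: "complex \<Rightarrow> (nat \<Rightarrow> complex \<Rightarrow> complex) \<Rightarrow> nat \<Rightarrow> complex \<Rightarrow> complex" where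
  "partial_continuation p a N s =
     (\<Sum>i<N. boundary_term (p - 2 * of_nat i) (peel_iter p a i) s)
     + expansion_sum (p - 2 * of_nat N) (peel_iter p a N) s"

text \<open>Where the remainder of stage \<open>N\<close> converges, every further peeling is an
  identity between convergent sums, so later stages agree with it.\<close>

lemma partial_continuation_eq:
  assumes a: "admissible r a" and s: "2 * Re s > Re p + 1 - 2 * real N" and "N \<le> M"
  shows "partial_continuation p a M s = partial_continuation p a N s"
  using \<open>N \<le> M\<close>
proof (induction M rule: dec_induct)
  case base
  then show ?case ..
next
  case (step M)
  have "2 * Re s > Re (p - 2 * of_nat M) + 1"
    using s step.hyps by simp
  from expansion_sum_peel[OF admissible_peel_iter[OF a r_pos r_less] this]
  have "expansion_sum (p - 2 * of_nat M) (peel_iter p a M) s =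
      boundary_term (p - 2 * of_nat M) (peel_iter p a M) s +
      expansion_sum (p - 2 * of_nat (Suc M)) (peel_iter p a (Suc M)) s"
    by (simp add: algebra_simps)
  then have "partial_continuation p a (Suc M) s = partial_continuation p a M s"
    unfolding partial_continuation_def by simp
  then show ?case using step.IH by simp
qed

text \<open>Any stage whose half-plane contains \<open>s\<close> gives the same value; taking the
  least one merely makes a choice.\<close>

definition continuation :: "complex \<Rightarrow> (nat \<Rightarrow> complex \<Rightarrow> complex) \<Rightarrow> complex \<Rightarrow> complex" where
  "continuation p a s = partial_continuation p a (LEAST N. 2 * Re s > Re p + 1 - 2 * real N) s"

lemma continuation_eq:
  assumes "admissible r a" "2 * Re s > Re p + 1 - 2 * real N"
  shows "continuation p a s = partial_continuation p a N s"
  unfolding continuation_def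
  using partial_continuation_eq[OF assms(1) LeastI[of "\<lambda>N. 2 * Re s > Re p + 1 - 2 * real N", OF assms(2)]
      Least_le[of "\<lambda>N. 2 * Re s > Re p + 1 - 2 * real N", OF assms(2)]]
  by simp

lemma continuation_eq_expansion_sum:
  assumes "admissible r a" "2 * Re s > Re p + 1"
  shows "continuation p a s = expansion_sum p a s"
  using continuation_eq[OF assms(1), of p 0 s] assms(2) by (simp add: partial_continuation_def)

lemma open_half_plane: "open {s. 2 * Re s > t}"
proof -
  have "{s. 2 * Re s > t} = {s. Re s > t / 2}" by auto
  then show ?thesis by (metis open_halfspace_Re_gt)
qed

lemma exists_half_plane: "\<exists>N. 2 * Re s > Re p + 1 - 2 * real N"
proof -
  obtain N where "real N > (Re p + 1 - 2 * Re s) / 2" using reals_Archimedean2 by blast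
  then show ?thesis by (intro exI[of _ N]) (simp add: field_simps)
qed

text \<open>Agreement on an open half-plane is agreement near \<open>s\<close>, which lets
  meromorphy and analyticity pass from a single stage to the glued function.\<close>

lemma eventually_continuation_eq:
  assumes "admissible r a" "2 * Re s > Re p + 1 - 2 * real N"
  shows "eventually (\<lambda>z. continuation p a z = partial_continuation p a N z) (nhds s)"
  using eventually_nhds_in_open[OF open_half_plane, of s "Re p + 1 - 2 * real N"] assms(2)
  by (auto elim!: eventually_mono intro: continuation_eq assms(1))

lemma expansion_sum_peel_iter_analytic:
  assumes "admissible r a" "2 * Re s > Re p + 1 - 2 * real N"
  shows "expansion_sum (p - 2 * of_nat N) (peel_iter p a N) analytic_on {s}"
  using expansion_sum_holomorphic[OF admissible_peel_iter[OF assms(1) r_pos r_less], of "p - 2 * of_nat N" p N]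
    open_half_plane assms(2)
  unfolding analytic_at by (intro exI[of _ "{s. 2 * Re s > Re (p - 2 * of_nat N) + 1}"]) auto

lemma continuation_meromorphic:
  assumes a: "admissible r a"
  shows "continuation p a meromorphic_on UNIV"
proof (subst meromorphic_on_meromorphic_at, intro ballI)
  fix s :: complex
  obtain N where N: "2 * Re s > Re p + 1 - 2 * real N" using exists_half_plane by blast
  have "peel_iter p a i 0 analytic_on {s}" for i
    using admissible_peel_iter[OF a r_pos r_less, of p i]
    by (auto simp: admissible_def analytic_on_open intro: analytic_on_subset[of _ UNIV])
  moreover have "(\<lambda>s. of_real c powr (q + 1 - 2 * s)) analytic_on {s}" for q
    using c_pos by (intro analytic_intros) auto
  ultimately have "partial_continuation p a N meromorphic_on {s}"
    unfolding partial_continuation_def[abs_def] boundary_term_def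
    by (intro meromorphic_intros analytic_on_imp_meromorphic_on[of "peel_iter p a _ 0"]
        analytic_on_imp_meromorphic_on[OF expansion_sum_peel_iter_analytic[OF a N]]
        analytic_on_imp_meromorphic_on[of "\<lambda>s. of_real c powr (_ - 2 * s)"]) auto
  also have "?this \<longleftrightarrow> continuation p a meromorphic_on {s}"
    using eventually_continuation_eq[OF a N]
    by (intro meromorphic_on_cong) (auto simp: eventually_nhds_conv_at elim: eventually_mono)
  finally show "continuation p a meromorphic_on {s}" .
qed

lemma continuation_analytic:
  assumes a: "admissible r a" and s: "\<And>i::nat. 2 * s \<noteq> p + 1 - 2 * of_nat i"
  shows "continuation p a analytic_on {s}"
proof -
  obtain N where N: "2 * Re s > Re p + 1 - 2 * real N" using exists_half_plane by blast
  have "peel_iter p a i 0 analytic_on {s}" for i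
    using admissible_peel_iter[OF a r_pos r_less, of p i]
    by (auto simp: admissible_def analytic_on_open intro: analytic_on_subset[of _ UNIV])
  moreover have "2 * (2 * s - (p - 2 * of_nat i) - 1) \<noteq> 0" for i
    using s[of i] unfolding mult_eq_0_iff by (auto simp: algebra_simps)
  ultimately have "partial_continuation p a N analytic_on {s}"
    unfolding partial_continuation_def[abs_def] boundary_term_def using c_pos
    by (intro analytic_intros expansion_sum_peel_iter_analytic[OF a N]) auto
  also have "?this \<longleftrightarrow> continuation p a analytic_on {s}"
    using eventually_continuation_eq[OF a N]
    by (intro analytic_at_cong) (auto elim: eventually_mono)
  finally show ?thesis .
qed

text \<open>This is a pointwise identity in \<open>y\<close>. It involves no sum over the nodes, so
  it is available at \<open>s\<close> where that sum diverges.\<close>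

lemma expansion_term_peel_iter:
  assumes a: "admissible r a" and y: "1 / y\<^sup>2 < r" "y > 1"
    and ne: "\<And>i. i < N \<Longrightarrow> 2 * s - (p - 2 * of_nat i) - 1 \<noteq> 0"
  shows "expansion_term p a y s =
    (\<Sum>i<N. peel_iter p a i 0 s / (2 * (2 * s - (p - 2 * of_nat i) - 1)) *
       (of_real (y - 1) powr (p - 2 * of_nat i + 1 - 2 * s)
        - of_real (y + 1) powr (p - 2 * of_nat i + 1 - 2 * s)))
    + expansion_term (p - 2 * of_nat N) (peel_iter p a N) y s"
  using ne
proof (induction N)
  case 0
  then show ?case by simp
next
  case (Suc N)
  have "expansion_term (p - 2 * of_nat N) (peel_iter p a N) y s =
    peel_iter p a N 0 s / (2 * (2 * s - (p - 2 * of_nat N) - 1)) *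
       (of_real (y - 1) powr (p - 2 * of_nat N + 1 - 2 * s)
        - of_real (y + 1) powr (p - 2 * of_nat N + 1 - 2 * s))
    + expansion_term (p - 2 * of_nat N - 2) (peel_iter p a (Suc N)) y s"
    unfolding peel_iter.simps
    by (rule expansion_term_peel[OF admissible_peel_iter[OF a r_pos r_less] r_less y Suc.prems]) simp
  moreover have "p - 2 * of_nat N - 2 = p - 2 * of_nat (Suc N)"
    by (simp add: algebra_simps)
  ultimately show ?case
    using Suc by (simp only: sum.lessThan_Suc add.assoc less_Suc_eq) simp
qed

text \<open>When $p - 2s = 2M$ is a nonnegative even integer, the boundary terms are odd monomials. If
  moreover the summand is a polynomial in the node, then the remainder left after $M + 1$ peeling
  steps is a polynomial that vanishes at infinity, hence is zero.\<close>

lemma continuation_at_polynomial: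
  fixes R :: "complex poly"
  assumes a: "admissible r a" and s: "p - 2 * s = 2 * of_nat M"
    and R: "\<And>n. expansion_term p a (node n) s = poly R (of_real (node n))"
  obtains G where "\<And>x. poly G (- x) = - poly G x"
    "\<And>x. poly R x = poly G (x - 1) - poly G (x + 1)"
    "continuation p a s = poly G (of_real c)"
proof -
  \<comment> \<open>The boundary exponents are then \<open>2*M + 1, ..., 3, 1\<close>, and the
    remainder starts with exponent -2, so its sum over the nodes converges.\<close>
  define N where "N = Suc M"
  define \<kappa> where "\<kappa> = (\<lambda>i. peel_iter p a i 0 s / (2 * (2 * s - (p - 2 * of_nat i) - 1)))"
  define G where "G = (\<Sum>i<N. monom (\<kappa> i) (2 * (M - i) + 1))"
  \<comment> \<open>\<open>Q\<close> is the remainder after \<open>N\<close> peelings, written as a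
    polynomial in the node.\<close>
  define Q where "Q = R - (G \<circ>\<^sub>p [:-1, 1:] - G \<circ>\<^sub>p [:1, 1:])"
  have G: "poly G x = (\<Sum>i<N. \<kappa> i * x ^ (2 * (M - i) + 1))" for x
    by (simp add: G_def poly_sum poly_monom)
  have ex: "p - 2 * of_nat i + 1 - 2 * s = of_nat (2 * (M - i) + 1)" if "i < N" for i
  proof -
    have "p - 2 * of_nat i + 1 - 2 * s = 2 * of_nat M - 2 * of_nat i + 1"
      using s by (simp add: algebra_simps)
    also have "\<dots> = of_nat (2 * (M - i) + 1)"
      using that by (simp add: N_def of_nat_diff less_Suc_eq_le algebra_simps)
    finally show ?thesis .
  qed
  have pw: "of_real x powr (p - 2 * of_nat i + 1 - 2 * s) = (of_real x ^ (2 * (M - i) + 1) :: complex)"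
    if "i < N" "x > 0" for i and x :: real
    unfolding ex[OF that(1)] using that(2) by (subst powr_nat') auto
  have ne: "2 * s - (p - 2 * of_nat i) - 1 \<noteq> 0" if "i < N" for i
  proof -
    have "2 * s - (p - 2 * of_nat i) - 1 = - (p - 2 * of_nat i + 1 - 2 * s)" by simp
    also have "\<dots> \<noteq> 0" unfolding ex[OF that] neg_equal_0_iff_equal of_nat_eq_0_iff by simp
    finally show ?thesis .
  qed
  have "poly Q (of_real (node n)) = expansion_term (p - 2 * of_nat N) (peel_iter p a N) (node n) s" for n
  proof -
    have "node n - 1 > 0" "node n + 1 > 0" using node_gt_1[of n] by auto
    then have "(\<Sum>i<N. \<kappa> i * (of_real (node n - 1) powr (p - 2 * of_nat i + 1 - 2 * s)
        - of_real (node n + 1) powr (p - 2 * of_nat i + 1 - 2 * s))) =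
      poly G (of_real (node n - 1)) - poly G (of_real (node n + 1))"
      unfolding G sum_subtractf[symmetric] right_diff_distrib
      by (intro sum.cong refl) (simp only: pw lessThan_iff)
    moreover note expansion_term_peel_iter[OF a inverse_node_less[of n] node_gt_1[of n], of N s p, OF ne]
    ultimately have "poly R (of_real (node n)) =
      (poly G (of_real (node n - 1)) - poly G (of_real (node n + 1)))
      + expansion_term (p - 2 * of_nat N) (peel_iter p a N) (node n) s"
      unfolding R[symmetric] \<kappa>_def by simp
    then show ?thesis by (simp add: Q_def poly_pcompose algebra_simps)
  qed
  moreover have "(\<lambda>n. expansion_term (p - 2 * of_nat N) (peel_iter p a N) (node n) s) \<longlonglongrightarrow> 0"
  proof (intro summable_LIMSEQ_zero expansion_term_summable admissible_peel_iter a r_pos r_less)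
    have "Re (p - 2 * s) = 2 * real M" unfolding s by simp
    then show "2 * Re s > Re (p - 2 * of_nat N) + 1" by (simp add: N_def)
  qed
  ultimately have "(\<lambda>n. poly Q (of_real (node n))) \<longlonglongrightarrow> 0" by simp
  moreover have "filterlim (\<lambda>n. of_real (node n) :: complex) at_infinity sequentially"
  proof -
    have "filterlim node at_top sequentially"
      by (intro filterlim_tendsto_add_at_top[OF tendsto_const]
          filterlim_tendsto_pos_mult_at_top[OF tendsto_const] filterlim_real_sequentially) auto
    then show ?thesis
      by (rule filterlim_compose[OF filterlim_of_real_at_infinity])
  qed
  ultimately have Q: "Q = 0"
    by (intro poly_eq_0_if_tendsto_0[of "\<lambda>n. of_real (node n)" sequentially]) auto
  \<comment> \<open>Each remainder term vanishes, hence so does the remainder sum, and only the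
    boundary terms contribute to the value.\<close>
  then have zero: "expansion_term (p - 2 * of_nat N) (peel_iter p a N) (node n) s = 0" for n
    using \<open>\<And>n. poly Q (of_real (node n)) = _\<close>[of n] by simp
  show ?thesis
  proof
    show "poly G (- x) = - poly G x" for x
      unfolding G sum_negf[symmetric] by (intro sum.cong) (auto simp: power_mult)
    show "poly R x = poly G (x - 1) - poly G (x + 1)" for x
    proof -
      have "poly Q x = 0" using Q by simp
      then show ?thesis by (simp add: Q_def poly_pcompose algebra_simps)
    qed
    have "Re (p - 2 * s) = 2 * real M" unfolding s by simp
    then have "continuation p a s = partial_continuation p a N s"
      by (intro continuation_eq a) (simp add: N_def)
    also have "\<dots> = (\<Sum>i<N. boundary_term (p - 2 * of_nat i) (peel_iter p a i) s)"
      by (simp add: partial_continuation_def expansion_sum_def zero)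
    also have "\<dots> = poly G (of_real c)"
      unfolding G boundary_term_def \<kappa>_def[symmetric]
      by (intro sum.cong refl) (simp only: pw[OF _ c_pos] lessThan_iff \<kappa>_def)
    finally show "continuation p a s = poly G (of_real c)" .
  qed
qed

end

section \<open>The series of odd-dimensional projective space\<close>

text \<open>Multiplication of the power series by \<open>1 - d * u\<close>.\<close>

definition times_one_minus :: "complex \<Rightarrow> (nat \<Rightarrow> complex \<Rightarrow> complex) \<Rightarrow> nat \<Rightarrow> complex \<Rightarrow> complex" where
  "times_one_minus d a j s = a j s + (- d) * shift_right a j s"

lemma admissible_times_one_minus:
  assumes "admissible r a" "r > 0"
  shows "admissible r (times_one_minus d a)"
proof -
  have "admissible r (\<lambda>j s. a j s + (- d) * shift_right a j s)"
    using assms by (intro admissible_add admissible_mult[where g = "\<lambda>_. - d"] admissible_shift_right) auto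
  then show ?thesis by (simp add: times_one_minus_def[abs_def])
qed

lemma suminf_times_one_minus:
  assumes "admissible r a" "norm u < r"
  shows "(\<Sum>j. times_one_minus d a j s * u ^ j) = (1 - d * u) * (\<Sum>j. a j s * u ^ j)"
proof -
  have su: "summable (\<lambda>j. a j s * u ^ j)" by (rule admissible_summable[OF assms])
  then have "(\<lambda>j. u * (a j s * u ^ j)) sums (u * (\<Sum>j. a j s * u ^ j))"
    by (intro sums_mult summable_sums)
  also have "(\<lambda>j. u * (a j s * u ^ j)) = (\<lambda>j. shift_right a (Suc j) s * u ^ Suc j)"
    by (simp add: shift_right_def mult_ac)
  finally have "(\<lambda>j. shift_right a j s * u ^ j) sums (u * (\<Sum>j. a j s * u ^ j))"
    using sums_Suc_iff[of "\<lambda>j. shift_right a j s * u ^ j"] by (simp add: shift_right_def)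
  then have "(\<lambda>j. a j s * u ^ j + (- d) * (shift_right a j s * u ^ j)) sums
      ((\<Sum>j. a j s * u ^ j) + (- d) * (u * (\<Sum>j. a j s * u ^ j)))"
    by (intro sums_add sums_mult summable_sums su)
  then show ?thesis
    by (simp add: sums_iff times_one_minus_def algebra_simps)
qed

lemma expansion_term_times_one_minus:
  assumes "admissible r a" "1 / y\<^sup>2 < r"
  shows "expansion_term p (times_one_minus d a) y s = (1 - d / of_real (y\<^sup>2)) * expansion_term p a y s"
proof -
  have "norm (of_real (1 / y\<^sup>2) :: complex) < r" using assms(2) by (subst norm_of_real) simp
  from suminf_times_one_minus[OF assms(1) this, of d s]
  show ?thesis by (simp add: expansion_term_def)
qed

text \<open>With $k = 2m + 1$ and $y = 2n + m$, the eigenvalue $2n(2n + k - 1)$ is $y^2 - m^2$ and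
  $P_k(2n) = \frac{2}{(2m)!} y^2 \prod_{j=1}^{m-1} (y^2 - j^2)$ is even in $y$.\<close>

primrec product_coeff :: "nat \<Rightarrow> nat \<Rightarrow> nat \<Rightarrow> complex \<Rightarrow> complex" where
  "product_coeff m 0 = (\<lambda>j s. ((- s) gchoose j) * of_real (- ((real m)\<^sup>2)) ^ j)"
| "product_coeff m (Suc i) = times_one_minus ((of_nat (Suc i))\<^sup>2) (product_coeff m i)"

definition mp_coeff :: "nat \<Rightarrow> nat \<Rightarrow> complex \<Rightarrow> complex" where
  "mp_coeff m j s = 2 / fact (2 * m) * product_coeff m (m - 1) j s"

text \<open>The factor \<open>(1 - m\<^sup>2 * u) powr (-s)\<close> is singular at
  \<open>u = 1 / m\<^sup>2\<close> when \<open>m > 0\<close>. The radius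
  \<open>1 / (m + 1)\<^sup>2\<close> stays below that point and still exceeds
  \<open>1 / (m + 2)\<^sup>2\<close>, the value of \<open>u\<close> at the first node
  \<open>m + 2\<close>.\<close>

lemma admissible_product_coeff: "admissible (1 / (real m + 1)\<^sup>2) (product_coeff m i)"
proof (induction i)
  case 0
  have "(real m)\<^sup>2 < (real m + 1)\<^sup>2" by (intro power_strict_mono) auto
  then have "\<bar>- ((real m)\<^sup>2)\<bar> * (1 / (real m + 1)\<^sup>2) < 1" by simp
  then show ?case
    unfolding product_coeff.simps by (intro admissible_gbinomial holomorphic_intros) auto
qed (auto intro: admissible_times_one_minus)

lemma admissible_mp_coeff: "admissible (1 / (real m + 1)\<^sup>2) (mp_coeff m)"
  using admissible_mult[OF admissible_product_coeff, of "\<lambda>_. 2 / fact (2 * m)" m "m - 1"]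
  by (simp add: mp_coeff_def[abs_def])

lemma expansion_term_product_coeff:
  assumes "y > real m + 1"
  shows "expansion_term p (product_coeff m i) y s =
    (\<Prod>j=1..i. 1 - (of_nat j)\<^sup>2 / of_real (y\<^sup>2)) * (of_real y powr (p - 2 * s)
      * of_real (1 - (real m)\<^sup>2 / y\<^sup>2) powr (- s))"
proof (induction i)
  case 0
  have "(real m)\<^sup>2 / y\<^sup>2 < 1"
    using assms by (simp add: divide_less_eq power_strict_mono)
  then have "norm (of_real (- ((real m)\<^sup>2 / y\<^sup>2)) :: complex) < 1"
    by (subst norm_of_real) simp
  from gen_binomial_complex[OF this, of "- s"]
  have "(\<lambda>j. ((- s) gchoose j) * of_real (- ((real m)\<^sup>2)) ^ j * of_real (1 / y\<^sup>2) ^ j) sums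
      of_real (1 - (real m)\<^sup>2 / y\<^sup>2) powr (- s)"
    by (simp add: mult.assoc flip: power_mult_distrib)
  then show ?case by (simp add: expansion_term_def sums_iff)
next
  case (Suc i)
  have "1 / y\<^sup>2 < 1 / (real m + 1)\<^sup>2"
    using assms by (intro divide_strict_left_mono power_strict_mono) auto
  from expansion_term_times_one_minus[OF admissible_product_coeff this] Suc.IH
  show ?case by (simp add: mult_ac)
qed

text \<open>All bases are positive reals, so the identity reduces to additivity of the real
  logarithm and no branch issue arises.\<close>

lemma powr_square_diff:
  fixes y m :: real and s :: complex
  assumes "y > m" "m \<ge> 0"
  shows "of_real y powr (- 2 * s) * of_real (1 - m\<^sup>2 / y\<^sup>2) powr (- s) = of_real (y\<^sup>2 - m\<^sup>2) powr (- s)"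
proof -
  have y: "y > 0" and d: "y\<^sup>2 - m\<^sup>2 > 0" and q: "1 - m\<^sup>2 / y\<^sup>2 > 0"
    using assms by (auto simp: divide_less_eq power_strict_mono)
  have "y\<^sup>2 - m\<^sup>2 = y\<^sup>2 * (1 - m\<^sup>2 / y\<^sup>2)" using y by (simp add: field_simps)
  then have l: "ln (y\<^sup>2 - m\<^sup>2) = 2 * ln y + ln (1 - m\<^sup>2 / y\<^sup>2)"
    using y q by (simp add: ln_mult ln_realpow)
  have e: "of_real x powr w = exp (w * of_real (ln x))" if "x > 0" for x and w :: complex
    using that by (simp add: powr_def Ln_of_real)
  show ?thesis
    unfolding e[OF y] e[OF d] e[OF q] l exp_add[symmetric] by (simp add: algebra_simps)
qed

lemma expansion_term_mp_coeff:
  assumes "y > real m + 1" "m \<ge> 1"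
  shows "expansion_term (2 * of_nat m) (mp_coeff m) y s =
    2 / fact (2 * m) * (of_real y)\<^sup>2 * (\<Prod>j=1..m-1. (of_real y)\<^sup>2 - (of_nat j)\<^sup>2) *
      of_real (y\<^sup>2 - (real m)\<^sup>2) powr (- s)"
proof -
  define Y :: complex where "Y = of_real y"
  have y: "y > 0" using assms by simp
  then have Y: "Y \<noteq> 0" by (simp add: Y_def)
  have "1 / y\<^sup>2 < 1 / (real m + 1)\<^sup>2"
    using assms by (intro divide_strict_left_mono power_strict_mono) auto
  then have nu: "norm (of_real (1 / y\<^sup>2) :: complex) < 1 / (real m + 1)\<^sup>2"
    by (subst norm_of_real) simp
  have "expansion_term (2 * of_nat m) (mp_coeff m) y s =
      2 / fact (2 * m) * expansion_term (2 * of_nat m) (product_coeff m (m - 1)) y s"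
    unfolding expansion_term_def mp_coeff_def mult.assoc
    by (subst suminf_mult[OF admissible_summable[OF admissible_product_coeff nu]]) (simp add: mult_ac)
  also have "expansion_term (2 * of_nat m) (product_coeff m (m - 1)) y s =
      (\<Prod>j=1..m-1. 1 - (of_nat j)\<^sup>2 / Y\<^sup>2) * (Y powr (2 * of_nat m - 2 * s) * of_real (1 - (real m)\<^sup>2 / y\<^sup>2) powr (- s))"
    using expansion_term_product_coeff[OF assms(1), of "2 * of_nat m" "m - 1" s] by (simp add: Y_def)
  also have "Y powr (2 * of_nat m - 2 * s) = Y powr of_nat (2 * m) * Y powr (- 2 * s)"
    by (subst powr_add[symmetric]) simp
  also have "Y powr of_nat (2 * m) = Y ^ (2 * m)"
    using Y by (subst powr_nat') auto
  also have "(\<Prod>j=1..m-1. 1 - (of_nat j)\<^sup>2 / Y\<^sup>2) * (Y ^ (2 * m) * Y powr (- 2 * s) * of_real (1 - (real m)\<^sup>2 / y\<^sup>2) powr (- s)) =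
      (Y ^ (2 * m) * (\<Prod>j=1..m-1. 1 - (of_nat j)\<^sup>2 / Y\<^sup>2)) * (Y powr (- 2 * s) * of_real (1 - (real m)\<^sup>2 / y\<^sup>2) powr (- s))"
    by (simp only: mult_ac)
  also have "Y powr (- 2 * s) * of_real (1 - (real m)\<^sup>2 / y\<^sup>2) powr (- s) = of_real (y\<^sup>2 - (real m)\<^sup>2) powr (- s)"
    unfolding Y_def by (rule powr_square_diff) (use assms in auto)
  also have "Y ^ (2 * m) * (\<Prod>j=1..m-1. 1 - (of_nat j)\<^sup>2 / Y\<^sup>2) = Y\<^sup>2 * (\<Prod>j=1..m-1. Y\<^sup>2 - (of_nat j)\<^sup>2)"
  proof -
    \<comment> \<open>Of the \<open>m\<close> factors \<open>Y\<^sup>2\<close>, one goes to each of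
      the \<open>m - 1\<close> terms of the product and one is left over.\<close>
    have "Y ^ (2 * m) = Y\<^sup>2 * (\<Prod>j=1..m-1. Y\<^sup>2)"
      using assms(2) by (simp add: power_mult flip: power_Suc)
    moreover have "(\<Prod>j=1..m-1. Y\<^sup>2) * (\<Prod>j=1..m-1. 1 - (of_nat j)\<^sup>2 / Y\<^sup>2) = (\<Prod>j=1..m-1. Y\<^sup>2 - (of_nat j)\<^sup>2)"
      unfolding prod.distrib[symmetric] using Y by (intro prod.cong refl) (simp add: field_simps)
    ultimately show ?thesis by (simp add: mult.assoc)
  qed
  finally show ?thesis by (simp only: Y_def mult.assoc)
qed

text \<open>The factors run from \<open>y - m\<close> to \<open>y + m\<close>; pairing opposite ones
  gives differences of squares. The induction step splits off the two outermost factors.\<close>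

lemma prod_symmetric_window:
  fixes y :: "'a::comm_ring_1"
  shows "(\<Prod>j=1..2*m+1. y - of_nat (m+1) + of_nat j) = y * (\<Prod>j=1..m. y\<^sup>2 - (of_nat j)\<^sup>2)"
proof (induction m)
  case 0
  then show ?case by simp
next
  case (Suc m)
  have "(\<Prod>j=1..2*Suc m+1. y - of_nat (Suc m+1) + of_nat j) =
      (\<Prod>j=Suc 0..Suc (2*m+1). y - of_nat (Suc m+1) + of_nat j) * (y + of_nat (Suc m))"
    by (simp add: algebra_simps)
  also have "(\<Prod>j=Suc 0..Suc (2*m+1). y - of_nat (Suc m+1) + of_nat j) =
      (y - of_nat (Suc m)) * (\<Prod>j=Suc 1..Suc (2*m+1). y - of_nat (Suc m+1) + of_nat j)"
    by (subst prod.atLeast_Suc_atMost) (auto simp: algebra_simps)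
  also have "(\<Prod>j=Suc 1..Suc (2*m+1). y - of_nat (Suc m+1) + of_nat j) =
      (\<Prod>j=1..2*m+1. y - of_nat (m+1) + of_nat j)"
    by (subst prod.shift_bounds_cl_Suc_ivl) (simp add: algebra_simps)
  finally show ?case
    unfolding Suc.IH by (simp add: algebra_simps power2_eq_square)
qed

lemma mp_poly_odd:
  assumes "m \<ge> 1"
  shows "mp_poly (2 * m + 1) (y - of_nat m) =
    2 / fact (2 * m) * y\<^sup>2 * (\<Prod>j=1..m-1. y\<^sup>2 - (of_nat j)\<^sup>2)"
proof -
  obtain l where m: "m = Suc l" using assms by (cases m) auto
  have "(\<Prod>j=1..2 * m + 1 - 2. y - of_nat m + of_nat j) = y * (\<Prod>j=1..m-1. y\<^sup>2 - (of_nat j)\<^sup>2)"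
    using prod_symmetric_window[of y l] by (simp add: m)
  moreover have "2 * (y - of_nat m) + of_nat (2 * m + 1) - 1 = 2 * y" by simp
  ultimately show ?thesis
    unfolding mp_poly_def by (simp only: diff_add_inverse2) (simp add: power2_eq_square)
qed

section \<open>Continuation and special values for \<open>k = 2m + 1\<close>\<close>

locale odd_projective_space =
  fixes m :: nat
  assumes m_pos: "m \<ge> 1"
begin

text \<open>With \<open>c = m + 1\<close>, \<open>node n\<close> is \<open>2 * (n + 1) + m\<close>,
  the value of \<open>y\<close> at the positive integer \<open>n + 1\<close>.\<close>

sublocale arithmetic_progression "real m + 1" "1 / (real m + 1)\<^sup>2"
proof
  show "1 / (real m + 1)\<^sup>2 < 1"
    using m_pos by (simp add: power2_eq_square divide_less_eq algebra_simps add_pos_nonneg)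
  show "1 / (real m + 1 + 1)\<^sup>2 < 1 / (real m + 1)\<^sup>2"
    by (intro divide_strict_left_mono power_strict_mono) auto
qed auto

text \<open>Removing singularities produces the normalisation demanded by \<open>is_mp_zeta\<close>:
  limits at removable singularities and 0 at poles.\<close>

definition L :: "complex \<Rightarrow> complex" where
  "L = remove_sings (continuation (2 * of_nat m) (mp_coeff m))"

lemma mp_series_eq: "mp_series (2 * m + 1) s = expansion_sum (2 * of_nat m) (mp_coeff m) s"
proof -
  have "mp_poly (2 * m + 1) (2 * of_nat (Suc n)) /
      (2 * of_nat (Suc n) * (2 * of_nat (Suc n) + of_nat (2 * m + 1) - 1)) powr s =
      expansion_term (2 * of_nat m) (mp_coeff m) (node n) s" for n
  proof -
    define y where "y = node n"
    have y: "2 * of_nat (Suc n) = (of_real y - of_nat m :: complex)"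
      by (simp add: y_def)
    have e: "(of_real y - of_nat m) * (of_real y - of_nat m + of_nat (2 * m + 1) - 1) =
        (of_real (y\<^sup>2 - (real m)\<^sup>2) :: complex)"
      by (simp add: power2_eq_square algebra_simps)
    have g: "y > real m + 1" by (simp add: y_def)
    show ?thesis
      unfolding y_def[symmetric] expansion_term_mp_coeff[OF g m_pos] y e mp_poly_odd[OF m_pos] powr_minus
      by (simp add: divide_inverse)
  qed
  then show ?thesis unfolding mp_series_def expansion_sum_def by simp
qed

lemma is_mp_zeta_L: "is_mp_zeta (2 * m + 1) L"
  unfolding is_mp_zeta_def
proof (intro conjI allI impI)
  let ?f = "continuation (2 * of_nat m) (mp_coeff m)"
  have mero: "?f meromorphic_on UNIV" by (rule continuation_meromorphic[OF admissible_mp_coeff])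
  then show "L nicely_meromorphic_on UNIV"
    unfolding L_def by (rule remove_sings_nicely_meromorphic)
  {
    fix s assume "is_pole L s"
    moreover have "isolated_singularity_at ?f s"
      using mero by (rule meromorphic_on_isolated_singularity[OF meromorphic_on_subset]) auto
    ultimately have "is_pole ?f s" by (simp add: L_def)
    then have "\<not> ?f analytic_on {s}"
      using analytic_at_imp_no_pole by blast
    then obtain i :: nat where "2 * s = 2 * of_nat m + 1 - 2 * of_nat i"
      using continuation_analytic[OF admissible_mp_coeff] by blast
    then have "s = of_nat (2 * m + 1) / 2 - of_nat i"
      by (simp add: field_simps)
    then show "\<exists>n::nat. s = of_nat (2 * m + 1) / 2 - of_nat n" ..
  }
  fix s :: complex assume "Re s > real (2 * m + 1) / 2"
  then have s: "2 * Re s > Re (2 * of_nat m) + 1" by simp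
  \<comment> \<open>The half-plane of convergence lies to the right of every possible pole, so
    removing singularities does not change the value there.\<close>
  have "2 * s \<noteq> 2 * of_nat m + 1 - 2 * of_nat i" for i :: nat
  proof
    assume "2 * s = 2 * of_nat m + 1 - 2 * of_nat i"
    then have "Re (2 * s) = Re (2 * of_nat m + 1 - 2 * of_nat i)" by simp
    then show False using s by simp
  qed
  then have "L s = ?f s"
    unfolding L_def by (intro remove_sings_at_analytic continuation_analytic admissible_mp_coeff)
  then show "L s = mp_series (2 * m + 1) s"
    unfolding mp_series_eq using continuation_eq_expansion_sum[OF admissible_mp_coeff s] by simp
qed

text \<open>The convention \<open>0 ^ 0 = 1\<close> lets one formula cover the value -1 at
  \<open>n = 0\<close> and the value 0 at positive \<open>n\<close>.\<close>

lemma L_neg_int: "L (- of_nat n) = - (0 ^ n)"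
proof -
  let ?f = "continuation (2 * of_nat m) (mp_coeff m)"
  define R :: "complex poly" where "R = Polynomial.smult (2 / fact (2 * m))
    ([:0, 1:]\<^sup>2 * (\<Prod>j=1..m-1. [:0, 1:]\<^sup>2 - [:(of_nat j)\<^sup>2:]) * ([:0, 1:]\<^sup>2 - [:(of_nat m)\<^sup>2:]) ^ n)"
  have R: "poly R x = mp_poly (2 * m + 1) (x - of_nat m) * (x\<^sup>2 - (of_nat m)\<^sup>2) ^ n" for x
    unfolding mp_poly_odd[OF m_pos] R_def by (simp add: poly_prod power2_eq_square)
  have s: "2 * of_nat m - 2 * (- of_nat n) = (2 * of_nat (m + n) :: complex)" by simp
  have "expansion_term (2 * of_nat m) (mp_coeff m) (node i) (- of_nat n) = poly R (of_real (node i))" for i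
  proof -
    define y where "y = node i"
    have g: "y > real m + 1" by (simp add: y_def)
    then have "y\<^sup>2 > (real m)\<^sup>2" by (intro power_strict_mono) auto
    then have "of_real (y\<^sup>2 - (real m)\<^sup>2) powr of_nat n = (of_real (y\<^sup>2 - (real m)\<^sup>2) ^ n :: complex)"
      by (subst powr_nat') (auto simp del: of_real_diff)
    then show ?thesis
      unfolding R mp_poly_odd[OF m_pos] y_def[symmetric] expansion_term_mp_coeff[OF g m_pos]
      by (simp add: power2_eq_square)
  qed
  from continuation_at_polynomial[OF admissible_mp_coeff s this] obtain G where odd: "\<And>x. poly G (- x) = - poly G x"
    and step: "\<And>x. poly R x = poly G (x - 1) - poly G (x + 1)"
    and val: "?f (- of_nat n) = poly G (of_real (real m + 1))"
    by blast
  \<comment> \<open>The factor \<open>y\<^sup>2\<close> vanishes at 0 and the factor with index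
    \<open>j\<close> vanishes at \<open>j\<close>, for \<open>j\<close> from 1 to
    \<open>m - 1\<close>.\<close>
  have R0: "poly R (of_nat j) = 0" if "j < m" for j
    using that unfolding R mp_poly_odd[OF m_pos]
    by (cases "j = 0") (auto simp: prod_zero_iff intro!: bexI[of _ j])
  \<comment> \<open>Two consecutive zeros are carried along because \<open>step\<close> links
    \<open>G\<close> at distance 2. Oddness gives \<open>G(0) = 0\<close>, and
    \<open>R(0) = G(-1) - G(1) = -2 * G(1)\<close> gives \<open>G(1) = 0\<close>.\<close>
  have "poly G (of_nat j) = 0 \<and> poly G (of_nat (Suc j)) = 0" if "j < m" for j
    using that
  proof (induction j)
    case 0
    then show ?case using odd[of 0] odd[of 1] step[of 0] R0[of 0] by simp
  next
    case (Suc j)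
    then show ?case using step[of "of_nat (Suc j)"] R0[of "Suc j"] by (simp add: add_ac)
  qed
  from this[of "m - 1"] have "poly G (of_nat m - 1) = 0" "poly G (of_nat m) = 0"
    using m_pos by (auto simp: of_nat_diff)
  \<comment> \<open>The value is \<open>G\<close> at \<open>c = m + 1\<close>, and
    \<open>R(m) = G(m - 1) - G(m + 1)\<close> with \<open>G(m - 1) = 0\<close>.\<close>
  then have "?f (- of_nat n) = - poly R (of_nat m)"
    using val step[of "of_nat m"] by simp
  \<comment> \<open>At \<open>y = m\<close> the eigenvalue \<open>y\<^sup>2 - m\<^sup>2\<close> is
    0, and the remaining factor is \<open>mp_poly (2 * m + 1) 0 = 1\<close>.\<close>
  also have "poly R (of_nat m) = 0 ^ n"
  proof -
    have "(\<Prod>j=1..2*m-1. of_nat j) = (fact (2*m-1) :: complex)"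
      by (simp add: fact_prod)
    moreover have "2 * of_nat m * fact (2*m-1) = (fact (2*m) :: complex)"
      using m_pos fact_reduce[of "2*m", where 'a = complex] by simp
    ultimately have "mp_poly (2 * m + 1) 0 = 1"
      by (simp add: mp_poly_def)
    then show ?thesis unfolding R by simp
  qed
  finally have "?f (- of_nat n) = - (0 ^ n)" .
  \<comment> \<open>Parity: possible poles are proper half-integers, so \<open>L\<close> agrees with
    the continuation at integers.\<close>
  moreover have "2 * (- of_nat n) \<noteq> 2 * of_nat m + 1 - (2 * of_nat i :: complex)" for i :: nat
  proof
    assume "2 * (- of_nat n) = 2 * of_nat m + 1 - (2 * of_nat i :: complex)"
    then have "of_int (2 * (int i - int n)) = (of_int (2 * int m + 1) :: complex)"
      by (simp add: algebra_simps)
    then have "2 * (int i - int n) = 2 * int m + 1" by (simp only: of_int_eq_iff)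
    then show False by presburger
  qed
  then have "L (- of_nat n) = ?f (- of_nat n)"
    unfolding L_def by (intro remove_sings_at_analytic continuation_analytic admissible_mp_coeff)
  ultimately show ?thesis by simp
qed

end

theorem theorem13:
  fixes k :: nat
  assumes "k \<ge> 2" and "odd k"
  shows "mp_zeta k 0 = -1 \<and> (\<forall>n::nat. n > 0 \<longrightarrow> mp_zeta k (- of_nat n) = 0)"
proof -
  from \<open>odd k\<close> obtain m where k: "k = 2 * m + 1" by (rule oddE)
  interpret odd_projective_space m
    by unfold_locales (use assms k in auto)
  \<comment> \<open>Uniqueness of the continuation makes the definite description in
    \<open>mp_zeta\<close> denote \<open>L\<close>.\<close>
  have "mp_zeta k = L"
    unfolding mp_zeta_def k using is_mp_zeta_L is_mp_zeta_unique by (intro the_equality) auto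
  then show ?thesis
    using L_neg_int[of 0] L_neg_int by (auto simp: power_0_left)
qed

end
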